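(* Let $\iota>0$, let $A^\top\Gamma^{-1}A$ be positive definite, and let $\varepsilon(t)=\frac{1}{t^\alpha+R}$ with $\alpha\in(0,1)$ and $R>0$. Let $u_0^{(j)}\in\Omega$ with $h_i(u_0^{(j)})<0$ for all $i=1,\dots,2m$, $j=1,\dots,J$, be the initial ensemble, and let $u_t=(u_t^{(j)})_{j=1}^J$, $t\ge0$, denote the solution of $$\frac{du_t^{(j)}}{dt}=-\iota D_t(u_t)\nabla\Phi(u_t^{(j)})+\sum_{i=1}^{2m}\frac{1}{h_i(u_t^{(j)})}\nabla h_i(u_t^{(j)}),\qquad j=1,\dots,J,$$ with initial values $u_0^{(j)}$, where $D_t$ is the preconditioner with variance inflation parameter $\varepsilon(t)$. Let $e_t^{(j)}=u_t^{(j)}-\bar u_t$. Then $$\frac1J\sum_{j=1}^J|e_t^{(j)}|^2\in\mathcal{O}(t^{-(1-\alpha)})\qquad\text{as } t\to\infty.$$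
   Context: Setting: $n,K,J,m\in\mathbb{N}$ with $m\le n$; $A\in\mathbb{R}^{K\times n}$, $y\in\mathbb{R}^K$, $\Gamma\in\mathbb{R}^{K\times K}$ symmetric positive definite; $\Phi(u)=\frac12\langle Au-y,\Gamma^{-1}(Au-y)\rangle$ for $u\in\mathbb{R}^n$. The box is $\Omega=\{u\in\mathbb{R}^n: a_i\le u_i\le b_i,\ i=1,\dots,m\}$ with real bounds $a_i,b_i$; set $h_i(u)=a_i-u_i$ and $h_{i+m}(u)=u_i-b_i$ for $i=1,\dots,m$, so $\Omega=\{u: h_i(u)\le 0,\ i=1,\dots,2m\}$. $|\cdot|$ is the Euclidean norm. For an ensemble $u=(u^{(j)})_{j=1}^J$ in $\mathbb{R}^n$ put $\bar u=\frac1J\sum_{j=1}^J u^{(j)}$, $C(u)=\frac1J\sum_{j=1}^J(u^{(j)}-\bar u)(u^{(j)}-\bar u)^\top$, and $$\mathcal I^+(u)=\Big\{i\in\{1,\dots,m\}:\ \big(\bar u_i=a_i,\ \tfrac{\partial\Phi}{\partial x_i}(\bar u)>0\big)\ \text{or}\ \big(\bar u_i=b_i,\ \tfrac{\partial\Phi}{\partial x_i}(\bar u)<0\big)\Big\}.$$ With time-dependent variance inflation $\varepsilon(t)$, the preconditioner $D_t(u)\in\mathbb{R}^{n\times n}$ is defined by $(D_t(u))_{i,k}=(C(u)+\varepsilon(t) I)_{i,k}$ if $i,k\notin\mathcal I^+(u)$; $(D_t(u))_{i,k}=0$ if $i\ne k$ and ($i\in\mathcal I^+(u)$ or $k\in\mathcal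 I^+(u)$); $(D_t(u))_{i,i}=\varepsilon(t)$ if $i\in\mathcal I^+(u)$. A solution is understood to exist for all $t\ge0$ and to satisfy $h_i(u_t^{(j)})<0$ for all $i,j$. *)

theory Defs
  imports "HOL-Analysis.Analysis" "HOL-Library.Landau_Symbols"
begin

text \<open>
  Vectors in \<open>\<real>\<^sup>n\<close> have type \<open>real^'n\<close>.  The type \<open>'n\<close> carries no order, so the numbering
  \<open>1,\<dots>,n\<close> of the coordinates is given by a bijection \<open>c\<close> from \<open>{1..CARD('n)}\<close> onto
  \<open>'n\<close>: the \<open>i\<close>-th coordinate of \<open>u\<close> is \<open>u $ c i\<close>.
  An ensemble of size \<open>J\<close> is a function on \<open>nat\<close> of which only the values at
  \<open>1,\<dots>,J\<close> are used.
\<close>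

definition pos_def_matrix :: "real^'n^'n \<Rightarrow> bool" where
  "pos_def_matrix M \<longleftrightarrow> transpose M = M \<and> (\<forall>x. x \<noteq> 0 \<longrightarrow> x \<bullet> (M *v x) > 0)"

text \<open>Meaningful where \<open>f\<close> is differentiable; the gradient is then unique.\<close>

definition gradient :: "('a::real_inner \<Rightarrow> real) \<Rightarrow> 'a \<Rightarrow> 'a" where
  "gradient f x = (THE d. GDERIV f x :> d)"

definition partial_deriv :: "'n \<Rightarrow> (real^'n \<Rightarrow> real) \<Rightarrow> real^'n \<Rightarrow> real" where
  "partial_deriv k f x = deriv (\<lambda>s. f (x + s *\<^sub>R axis k 1)) 0"

definition Phi :: "real^'n^'k \<Rightarrow> real^'k \<Rightarrow> real^'k^'k \<Rightarrow> real^'n \<Rightarrow> real" where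
  "Phi A y \<Gamma> u = 1/2 * ((A *v u - y) \<bullet> (matrix_inv \<Gamma> *v (A *v u - y)))"

definition box_constraint ::
  "(nat \<Rightarrow> 'n) \<Rightarrow> nat \<Rightarrow> (nat \<Rightarrow> real) \<Rightarrow> (nat \<Rightarrow> real) \<Rightarrow> nat \<Rightarrow> real^'n \<Rightarrow> real" where
  "box_constraint c m a b i u = (if i \<le> m then a i - u $ c i else u $ c (i - m) - b (i - m))"

definition box_domain ::
  "(nat \<Rightarrow> 'n) \<Rightarrow> nat \<Rightarrow> (nat \<Rightarrow> real) \<Rightarrow> (nat \<Rightarrow> real) \<Rightarrow> (real^'n) set" where
  "box_domain c m a b = {u. \<forall>i\<in>{1..m}. a i \<le> u $ c i \<and> u $ c i \<le> b i}"

definition ens_mean :: "nat \<Rightarrow> (nat \<Rightarrow> real^'n) \<Rightarrow> real^'n" where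
  "ens_mean J u = (1 / real J) *\<^sub>R (\<Sum>j=1..J. u j)"

definition ens_cov :: "nat \<Rightarrow> (nat \<Rightarrow> real^'n) \<Rightarrow> real^'n^'n" where
  "ens_cov J u = (1 / real J) *\<^sub>R
     (\<Sum>j=1..J. \<chi> p q. (u j - ens_mean J u) $ p * (u j - ens_mean J u) $ q)"

definition active_set ::
  "(nat \<Rightarrow> 'n) \<Rightarrow> nat \<Rightarrow> (nat \<Rightarrow> real) \<Rightarrow> (nat \<Rightarrow> real) \<Rightarrow> (real^'n \<Rightarrow> real) \<Rightarrow>
   nat \<Rightarrow> (nat \<Rightarrow> real^'n) \<Rightarrow> nat set" where
  "active_set c m a b \<Phi> J u = {i \<in> {1..m}.
     (ens_mean J u $ c i = a i \<and> partial_deriv (c i) \<Phi> (ens_mean J u) > 0) \<or>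
     (ens_mean J u $ c i = b i \<and> partial_deriv (c i) \<Phi> (ens_mean J u) < 0)}"

text \<open>\<open>eps\<close> is the value of the variance inflation at the current time.\<close>

definition preconditioner ::
  "(nat \<Rightarrow> 'n) \<Rightarrow> nat \<Rightarrow> (nat \<Rightarrow> real) \<Rightarrow> (nat \<Rightarrow> real) \<Rightarrow> (real^'n \<Rightarrow> real) \<Rightarrow>
   nat \<Rightarrow> real \<Rightarrow> (nat \<Rightarrow> real^'n) \<Rightarrow> real^'n^'n" where
  "preconditioner c m a b \<Phi> J eps u = (\<chi> p q.
     if p \<notin> c ` active_set c m a b \<Phi> J u \<and> q \<notin> c ` active_set c m a b \<Phi> J u
     then (ens_cov J u + eps *\<^sub>R mat 1) $ p $ q
     else if p \<noteq> q then 0 else eps)"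

definition eki_rhs ::
  "(nat \<Rightarrow> 'n) \<Rightarrow> nat \<Rightarrow> (nat \<Rightarrow> real) \<Rightarrow> (nat \<Rightarrow> real) \<Rightarrow> (real^'n \<Rightarrow> real) \<Rightarrow>
   real \<Rightarrow> nat \<Rightarrow> real \<Rightarrow> (nat \<Rightarrow> real^'n) \<Rightarrow> nat \<Rightarrow> real^'n" where
  "eki_rhs c m a b \<Phi> \<iota> J eps u j =
     - (\<iota> *\<^sub>R (preconditioner c m a b \<Phi> J eps u *v gradient \<Phi> (u j)))
     + (\<Sum>i=1..2*m. (1 / box_constraint c m a b i (u j)) *\<^sub>R
                     gradient (box_constraint c m a b i) (u j))"

end

theory Submission
  imports Defs "HOL-Real_Asymp.Real_Asymp"
begin

text \<open>
  Let \<open>V\<close> be the ensemble spread, the mean of \<open>|e j|\<^sup>2\<close> over the deviations \<open>e j\<close> of the particles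
  from their mean, and let \<open>H = A\<^sup>T \<Gamma>\<^sup>-\<^sup>1 A\<close>.  The proof is an energy estimate for \<open>V\<close>.

  All particles are strictly inside the box, hence so is their mean.  So the active set is empty
  and the preconditioner is the full matrix \<open>C + \<epsilon> I\<close>.  As the deviations sum to \<open>0\<close>, everything that
  is common to all particles drops out of the derivative of \<open>V\<close>, in particular the motion of the
  mean and the gradient of \<open>\<Phi>\<close> at the mean.  Three contributions remain:
  \<^item> The covariance part, a negative multiple of \<open>\<Sum>j k. (e j \<bullet> e k) (e k \<bullet> H e j)\<close>.  This sum is
    \<open>J\<^sup>2\<close> times the trace of \<open>C H C\<close>, hence nonnegative (\<open>sum_gram_product_nonneg\<close>).
  \<^item> The inflation part, at most \<open>- 2 \<iota> \<epsilon> l V\<close> for any \<open>l > 0\<close> with \<open>l |x|\<^sup>2 \<le> x \<bullet> H x\<close>.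
  \<^item> The barrier part.  It is the gradient of a concave function, so it draws the particles together
    and contributes a nonpositive amount (\<open>barrier_dissipative\<close>).

  Together they give \<open>V' \<le> - 2 \<iota> l \<epsilon>(t) V\<close> (\<open>eki_rhs_dissipative\<close>, \<open>has_real_derivative_ensemble_spread\<close>).
  Since \<open>\<alpha> < 1\<close>, the rate \<open>2 \<iota> l \<epsilon>(t)\<close> eventually exceeds \<open>1/t\<close>; from then on \<open>t V(t)\<close> does not increase
  (\<open>decay_from_vanishing_rate\<close>).  Thus \<open>V \<in> O(1/t)\<close>, and \<open>1/t \<le> t powr -(1 - \<alpha>)\<close> for large \<open>t\<close>.
\<close>

section \<open>Quadratic forms and gradients\<close>

lemma gradient_eqI:
  assumes "GDERIV f x :> d"
  shows "gradient f x = d"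
  unfolding gradient_def
proof (rule the_equality)
  fix d' assume "GDERIV f x :> d'"
  with assms have "(\<lambda>h. h \<bullet> d) = (\<lambda>h. h \<bullet> d')"
    unfolding gderiv_def by (rule has_derivative_unique)
  then show "d' = d" by (metis vector_eq_ldot)
qed (rule assms)

text \<open>By compactness the quadratic form has a minimum on the unit sphere, which is positive.
  Homogeneity carries the bound over to all vectors.\<close>

lemma pos_def_matrix_coercive:
  fixes M :: "real^'n^'n"
  assumes "pos_def_matrix M"
  shows "\<exists>l>0. \<forall>x. l * (norm x)\<^sup>2 \<le> x \<bullet> (M *v x)"
proof -
  have "compact (sphere (0::real^'n) 1)" by simp
  moreover have "sphere (0::real^'n) 1 \<noteq> {}" by simp
  moreover have "continuous_on (sphere 0 1) (\<lambda>x. x \<bullet> (M *v x))"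
    by (intro continuous_intros)
  ultimately obtain z where z: "z \<in> sphere 0 1"
      and min: "\<And>x. x \<in> sphere 0 1 \<Longrightarrow> z \<bullet> (M *v z) \<le> x \<bullet> (M *v x)"
    by (meson continuous_attains_inf)
  have "z \<bullet> (M *v z) * (norm x)\<^sup>2 \<le> x \<bullet> (M *v x)" for x
  proof (cases "x = 0")
    case False
    then have "z \<bullet> (M *v z) \<le> (x /\<^sub>R norm x) \<bullet> (M *v (x /\<^sub>R norm x))"
      by (intro min) simp
    also have "\<dots> = (x \<bullet> (M *v x)) / (norm x)\<^sup>2"
      by (simp add: matrix_vector_mult_scaleR power2_eq_square field_simps)
    finally show ?thesis using False by (simp add: field_simps)
  qed simp
  moreover have "z \<bullet> (M *v z) > 0"
  proof -
    from z have "z \<noteq> 0" by auto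
    then show ?thesis using assms by (simp add: pos_def_matrix_def)
  qed
  ultimately show ?thesis by blast
qed

lemma pos_def_matrix_inv_symmetric:
  fixes M :: "real^'n^'n"
  assumes "pos_def_matrix M"
  shows "transpose (matrix_inv M) = matrix_inv M"
proof -
  have sym: "transpose M = M" and pos: "\<And>x. x \<noteq> 0 \<Longrightarrow> x \<bullet> (M *v x) > 0"
    using assms by (auto simp: pos_def_matrix_def)
  have "\<forall>x. M *v x = 0 \<longrightarrow> x = 0"
    using pos by (metis inner_zero_right less_irrefl)
  then have "invertible M"
    by (simp add: invertible_left_inverse matrix_left_invertible_ker)
  then have right: "M ** matrix_inv M = mat 1"
    unfolding invertible_def matrix_inv_def by (rule someI2_ex) simp
  have l: "transpose (matrix_inv M) ** M = mat 1"
    using matrix_transpose_mul[of M "matrix_inv M"] right sym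
    by (simp add: transpose_mat)
  have "transpose (matrix_inv M) = transpose (matrix_inv M) ** (M ** matrix_inv M)"
    by (simp add: right)
  also have "\<dots> = matrix_inv M" by (simp add: matrix_mul_assoc l)
  finally show ?thesis .
qed

text \<open>Symmetry of the weight makes the two terms of the product rule equal, which cancels the
  factor \<open>1/2\<close>.\<close>

lemma gradient_Phi:
  fixes A :: "real^'n^'k"
  assumes "transpose (matrix_inv \<Gamma>) = matrix_inv \<Gamma>"
  shows "gradient (Phi A y \<Gamma>) x = transpose A *v (matrix_inv \<Gamma> *v (A *v x - y))"
proof (rule gradient_eqI)
  let ?G = "matrix_inv \<Gamma>"
  have "(Phi A y \<Gamma> has_derivative (\<lambda>h. 1/2 * ((A *v x - y) \<bullet> (?G *v (A *v h))
            + (A *v h) \<bullet> (?G *v (A *v x - y))))) (at x)"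
    unfolding Phi_def[abs_def]
    by (auto intro!: derivative_eq_intros
          bounded_linear.has_derivative[OF matrix_vector_mul_bounded_linear])
  moreover have "(A *v x - y) \<bullet> (?G *v (A *v h)) = (A *v h) \<bullet> (?G *v (A *v x - y))" for h
    by (metis assms dot_lmul_matrix inner_commute transpose_matrix_vector)
  moreover have "(A *v h) \<bullet> z = h \<bullet> (transpose A *v z)" for h z
    by (metis dot_lmul_matrix inner_commute transpose_matrix_vector)
  ultimately show "GDERIV (Phi A y \<Gamma>) x :> transpose A *v (?G *v (A *v x - y))"
    by (simp add: gderiv_def)
qed

section \<open>The box constraints at the ensemble mean\<close>

text \<open>The outer unit normal of the face on which the \<open>i\<close>-th constraint vanishes.\<close>

definition box_normal :: "(nat \<Rightarrow> 'n) \<Rightarrow> nat \<Rightarrow> nat \<Rightarrow> real^'n" where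
  "box_normal c m i = (if i \<le> m then - axis (c i) 1 else axis (c (i - m)) 1)"

lemma box_constraint_affine:
  "box_constraint c m a b i v = box_constraint c m a b i w + box_normal c m i \<bullet> (v - w)"
  by (simp add: box_constraint_def box_normal_def inner_axis' inner_diff_right)

lemma gradient_box_constraint:
  "gradient (box_constraint c m a b i) x = box_normal c m i"
proof (rule gradient_eqI)
  have "box_constraint c m a b i
          = (\<lambda>v. box_constraint c m a b i 0 + v \<bullet> box_normal c m i)"
    by (rule ext, subst box_constraint_affine[where w = 0]) (simp add: inner_commute)
  moreover have "((\<lambda>v. box_constraint c m a b i 0 + v \<bullet> box_normal c m i)
      has_derivative (\<lambda>h. h \<bullet> box_normal c m i)) (at x)"
    by (auto intro!: derivative_eq_intros)
  ultimately show "GDERIV (box_constraint c m a b i) x :> box_normal c m i"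
    by (simp add: gderiv_def)
qed

lemma sum_deviation_ens_mean:
  assumes "J \<ge> 1"
  shows "(\<Sum>j=1..J. u j - ens_mean J u) = 0"
  using assms by (simp add: sum_subtractf ens_mean_def sum_constant_scaleR del: sum_constant)

lemma sum_deviation_inner_const:
  assumes "J \<ge> 1"
  shows "(\<Sum>j=1..J. (u j - ens_mean J u) \<bullet> z) = 0"
  using sum_deviation_ens_mean[OF assms, of u] by (metis inner_sum_left inner_zero_left)

text \<open>An affine function takes at the mean of the particles the mean of its values.\<close>

lemma box_constraint_ens_mean_neg:
  assumes "J \<ge> 1" and neg: "\<And>j. j \<in> {1..J} \<Longrightarrow> box_constraint c m a b i (u j) < 0"
  shows "box_constraint c m a b i (ens_mean J u) < 0"
proof -
  let ?h = "box_constraint c m a b i" and ?v = "ens_mean J u"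
  have "(\<Sum>j=1..J. ?h (u j)) = (\<Sum>j=1..J. ?h ?v + (u j - ?v) \<bullet> box_normal c m i)"
    by (rule sum.cong[OF refl], subst box_constraint_affine[where w = ?v])
       (simp add: inner_commute)
  also have "\<dots> = real J * ?h ?v"
    by (simp only: sum.distrib sum_deviation_inner_const[OF assms(1)]) simp
  finally have "real J * ?h ?v < 0"
    using sum_strict_mono[of "{1..J}" "\<lambda>j. ?h (u j)" "\<lambda>j. 0"] neg assms(1) by auto
  then show ?thesis by (simp add: mult_less_0_iff)
qed

text \<open>A coordinate can be active only when the mean lies on one of its two faces; the constraints
  \<open>i\<close> and \<open>i + m\<close> exclude the lower and the upper one.\<close>

lemma active_set_empty:
  assumes "J \<ge> 1"
    and neg: "\<And>i j. i \<in> {1..2*m} \<Longrightarrow> j \<in> {1..J} \<Longrightarrow> box_constraint c m a b i (u j) < 0"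
  shows "active_set c m a b \<Phi> J u = {}"
proof -
  let ?v = "ens_mean J u"
  have "?v $ c i \<noteq> a i \<and> ?v $ c i \<noteq> b i" if i: "i \<in> {1..m}" for i
  proof -
    have "box_constraint c m a b i ?v < 0" "box_constraint c m a b (i + m) ?v < 0"
      by (rule box_constraint_ens_mean_neg[OF assms(1)], rule neg, use i in auto)+
    then show ?thesis using i by (auto simp: box_constraint_def split: if_splits)
  qed
  then show ?thesis by (auto simp: active_set_def)
qed

lemma preconditioner_inactive:
  assumes "active_set c m a b \<Phi> J u = {}"
  shows "preconditioner c m a b \<Phi> J eps u = ens_cov J u + eps *\<^sub>R mat 1"
  by (simp add: preconditioner_def assms vec_eq_iff)

section \<open>Dissipation of the ensemble spread\<close>

lemma ens_cov_mult_vec: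
  "ens_cov J u *v x = (1 / real J) *\<^sub>R
     (\<Sum>k=1..J. ((u k - ens_mean J u) \<bullet> x) *\<^sub>R (u k - ens_mean J u))"
  by (simp add: vec_eq_iff ens_cov_def matrix_vector_mult_def inner_vec_def
      sum_distrib_left sum_distrib_right sum.swap[of _ UNIV "{Suc 0..J}"] mult_ac)

text \<open>The sum is the trace of \<open>W H W\<close>, where \<open>W\<close> is the symmetric matrix \<open>\<Sum>j. e j (e j)\<^sup>T\<close>.  Expanding
  \<open>e j \<bullet> e k\<close> in coordinates writes it as the sum of \<open>w p \<bullet> H w p\<close> over the columns \<open>w p\<close> of \<open>W\<close>.\<close>

lemma sum_gram_product_nonneg:
  fixes e :: "'j \<Rightarrow> real^'n" and H :: "real^'n^'n"
  assumes "\<And>x. 0 \<le> x \<bullet> (H *v x)"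
  shows "0 \<le> (\<Sum>j\<in>S. \<Sum>k\<in>S. (e j \<bullet> e k) * (e k \<bullet> (H *v e j)))"
proof -
  define w where "w p = (\<Sum>j\<in>S. (e j $ p) *\<^sub>R e j)" for p
  have Hw: "H *v w p = (\<Sum>j\<in>S. (e j $ p) *\<^sub>R (H *v e j))" for p
    unfolding w_def by (simp add: linear_sum matrix_vector_mult_scaleR
      matrix_vector_mul_linear flip: matrix_vector_mult_scaleR)
  have "(\<Sum>j\<in>S. \<Sum>k\<in>S. (e j \<bullet> e k) * (e k \<bullet> (H *v e j)))
      = (\<Sum>j\<in>S. \<Sum>k\<in>S. \<Sum>p\<in>UNIV. (e j $ p) * (e k $ p) * (e k \<bullet> (H *v e j)))"
    by (simp add: inner_vec_def[of "e _" "e _"] sum_distrib_right)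
  also have "\<dots> = (\<Sum>j\<in>S. \<Sum>p\<in>UNIV. \<Sum>k\<in>S. (e j $ p) * (e k $ p) * (e k \<bullet> (H *v e j)))"
    by (intro sum.cong refl sum.swap)
  also have "\<dots> = (\<Sum>p\<in>UNIV. \<Sum>j\<in>S. \<Sum>k\<in>S. (e j $ p) * (e k $ p) * (e k \<bullet> (H *v e j)))"
    by (rule sum.swap)
  also have "\<dots> = (\<Sum>p\<in>UNIV. w p \<bullet> (H *v w p))"
    unfolding Hw
    by (simp add: w_def inner_sum_left inner_sum_right sum_distrib_left mult_ac)
  also have "\<dots> \<ge> 0" by (intro sum_nonneg assms)
  finally show ?thesis .
qed

text \<open>The values of an affine constraint at the particles have the form \<open>h0 + s j\<close>, where \<open>h0\<close> is its
  value at the mean and the \<open>s j\<close> sum to \<open>0\<close>.  Because \<open>x \<mapsto> 1/x\<close> decreases on the negative axis,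
  replacing each denominator by \<open>h0\<close> only increases the sum, which then vanishes.\<close>

lemma barrier_dissipative:
  fixes h0 :: real
  assumes "finite S" and "(\<Sum>j\<in>S. s j) = 0" and "h0 < 0" and "\<And>j. j \<in> S \<Longrightarrow> h0 + s j < 0"
  shows "(\<Sum>j\<in>S. s j / (h0 + s j)) \<le> 0"
proof -
  have "s j / (h0 + s j) \<le> s j / h0" if "j \<in> S" for j
  proof -
    have "s j / (h0 + s j) - s j / h0 = - ((s j)\<^sup>2 / (h0 * (h0 + s j)))"
      using assms(3) assms(4)[OF that] by (simp add: field_simps power2_eq_square)
    moreover have "0 < h0 * (h0 + s j)"
      using assms(3) assms(4)[OF that] by (rule mult_neg_neg)
    ultimately show ?thesis by (smt (verit) divide_nonneg_pos zero_le_power2)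
  qed
  then have "(\<Sum>j\<in>S. s j / (h0 + s j)) \<le> (\<Sum>j\<in>S. s j / h0)" by (rule sum_mono)
  also have "\<dots> = 0" by (simp add: assms(2) flip: sum_divide_distrib)
  finally show ?thesis .
qed

text \<open>The energy estimate: \<open>cov\<close>, \<open>drift\<close> and \<open>barrier\<close> treat the covariance part, the whole
  preconditioned gradient and the logarithmic barrier.\<close>

lemma eki_rhs_dissipative:
  fixes A :: "real^'n^'k" and \<Gamma> :: "real^'k^'k" and u :: "nat \<Rightarrow> real^'n" and J :: nat
  defines "H \<equiv> transpose A ** matrix_inv \<Gamma> ** A" and "e \<equiv> \<lambda>j. u j - ens_mean J u"
  assumes J: "J \<ge> 1" and \<Gamma>: "pos_def_matrix \<Gamma>" and "\<iota> \<ge> 0" and "eps \<ge> 0"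
    and "l \<ge> 0" and coercive: "\<And>x. l * (norm x)\<^sup>2 \<le> x \<bullet> (H *v x)"
    and neg: "\<And>i j. i \<in> {1..2*m} \<Longrightarrow> j \<in> {1..J} \<Longrightarrow> box_constraint c m a b i (u j) < 0"
  shows "(\<Sum>j=1..J. e j \<bullet> eki_rhs c m a b (Phi A y \<Gamma>) \<iota> J eps u j)
           \<le> - (\<iota> * eps * l * (\<Sum>j=1..J. (norm (e j))\<^sup>2))"
proof -
  let ?v = "ens_mean J u" and ?\<Phi> = "Phi A y \<Gamma>" and ?h = "box_constraint c m a b"
  let ?D = "ens_cov J u + eps *\<^sub>R mat 1"
  have D: "preconditioner c m a b ?\<Phi> J eps u = ?D"
    by (rule preconditioner_inactive[OF active_set_empty[OF J neg]])
  have e0: "(\<Sum>j=1..J. e j \<bullet> z) = 0" for z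
    unfolding e_def by (rule sum_deviation_inner_const[OF J])
  \<comment> \<open>\<open>\<Phi>\<close> is quadratic with Hessian \<open>H\<close>; the value at the mean is the same for all particles and
      cancels in sums against \<open>e j\<close>.\<close>
  have grad: "gradient ?\<Phi> (u j) = gradient ?\<Phi> ?v + H *v e j" for j
    by (simp add: gradient_Phi pos_def_matrix_inv_symmetric[OF \<Gamma>] H_def e_def
        matrix_vector_mult_diff_distrib flip: matrix_vector_mul_assoc)

  have cov: "0 \<le> (\<Sum>j=1..J. e j \<bullet> (ens_cov J u *v (H *v e j)))"
  proof -
    have pos: "0 \<le> x \<bullet> (H *v x)" for x
      using coercive[of x] \<open>l \<ge> 0\<close> by (smt (verit) mult_nonneg_nonneg zero_le_power2)
    have "(\<Sum>j=1..J. e j \<bullet> (ens_cov J u *v (H *v e j)))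
        = (1 / real J) * (\<Sum>j=1..J. \<Sum>k=1..J. (e j \<bullet> e k) * (e k \<bullet> (H *v e j)))"
      unfolding ens_cov_mult_vec e_def[symmetric]
      by (simp add: inner_sum_right sum_distrib_left e_def mult_ac)
    then show ?thesis using sum_gram_product_nonneg[OF pos, where S = "{1..J}" and e = e] by simp
  qed

  have drift: "eps * l * (\<Sum>j=1..J. (norm (e j))\<^sup>2)
                 \<le> (\<Sum>j=1..J. e j \<bullet> (?D *v gradient ?\<Phi> (u j)))"
  proof -
    have "(\<Sum>j=1..J. e j \<bullet> (?D *v gradient ?\<Phi> (u j)))
        = (\<Sum>j=1..J. e j \<bullet> (?D *v gradient ?\<Phi> ?v)) + (\<Sum>j=1..J. e j \<bullet> (?D *v (H *v e j)))"
      by (simp add: grad matrix_vector_right_distrib inner_add_right sum.distrib)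
    also have "(\<Sum>j=1..J. e j \<bullet> (?D *v gradient ?\<Phi> ?v)) = 0" by (rule e0)
    also have "0 + (\<Sum>j=1..J. e j \<bullet> (?D *v (H *v e j))) = (\<Sum>j=1..J. e j \<bullet> (ens_cov J u *v (H *v e j)))
                    + eps * (\<Sum>j=1..J. e j \<bullet> (H *v e j))"
      by (simp add: matrix_vector_mult_add_rdistrib inner_add_right sum.distrib
          sum_distrib_left flip: scaleR_matrix_vector_assoc)
    also have "\<dots> \<ge> eps * (\<Sum>j=1..J. e j \<bullet> (H *v e j))" using cov by simp
    finally have "eps * (\<Sum>j=1..J. e j \<bullet> (H *v e j)) \<le> (\<Sum>j=1..J. e j \<bullet> (?D *v gradient ?\<Phi> (u j)))" .
    moreover have "(\<Sum>j=1..J. l * (norm (e j))\<^sup>2) \<le> (\<Sum>j=1..J. e j \<bullet> (H *v e j))"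
      by (intro sum_mono coercive)
    from mult_left_mono[OF this \<open>eps \<ge> 0\<close>]
    have "eps * l * (\<Sum>j=1..J. (norm (e j))\<^sup>2) \<le> eps * (\<Sum>j=1..J. e j \<bullet> (H *v e j))"
      by (simp add: mult.assoc flip: sum_distrib_left)
    ultimately show ?thesis by linarith
  qed

  have barrier: "(\<Sum>j=1..J. e j \<bullet> (\<Sum>i=1..2*m. (1 / ?h i (u j)) *\<^sub>R gradient (?h i) (u j))) \<le> 0"
  proof -
    have "(\<Sum>j=1..J. e j \<bullet> (\<Sum>i=1..2*m. (1 / ?h i (u j)) *\<^sub>R gradient (?h i) (u j)))
        = (\<Sum>i=1..2*m. \<Sum>j=1..J. (e j \<bullet> box_normal c m i) / ?h i (u j))"
      by (subst sum.swap) (simp add: inner_sum_right gradient_box_constraint)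
    also have "\<dots> \<le> 0"
    proof (rule sum_nonpos)
      fix i assume i: "i \<in> {1..2*m}"
      have h: "?h i (u j) = ?h i ?v + e j \<bullet> box_normal c m i" for j
        by (subst box_constraint_affine[where w = ?v]) (simp add: e_def inner_commute)
      show "(\<Sum>j=1..J. (e j \<bullet> box_normal c m i) / ?h i (u j)) \<le> 0"
        unfolding h
      proof (rule barrier_dissipative)
        show "?h i ?v < 0" by (rule box_constraint_ens_mean_neg[OF J neg[OF i]])
        show "?h i ?v + e j \<bullet> box_normal c m i < 0" if "j \<in> {1..J}" for j
          using neg[OF i that] unfolding h .
      qed (simp_all add: e0 del: One_nat_def)
    qed
    finally show ?thesis .
  qed

  have "(\<Sum>j=1..J. e j \<bullet> eki_rhs c m a b ?\<Phi> \<iota> J eps u j)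
      = - (\<iota> * (\<Sum>j=1..J. e j \<bullet> (?D *v gradient ?\<Phi> (u j))))
        + (\<Sum>j=1..J. e j \<bullet> (\<Sum>i=1..2*m. (1 / ?h i (u j)) *\<^sub>R gradient (?h i) (u j)))"
    unfolding eki_rhs_def D
    by (simp only: inner_add_right inner_minus_right inner_scaleR_right sum.distrib sum_negf
        sum_distrib_left)
  also have "\<dots> \<le> - (\<iota> * (eps * l * (\<Sum>j=1..J. (norm (e j))\<^sup>2)))"
    using barrier mult_left_mono[OF drift \<open>\<iota> \<ge> 0\<close>] by linarith
  finally show ?thesis by (simp add: mult.assoc)
qed

text \<open>The velocity of the mean is common to all particles, so its products with the deviations
  cancel and only the particle velocities appear.\<close>

lemma has_real_derivative_ensemble_spread:
  fixes u :: "real \<Rightarrow> nat \<Rightarrow> real^'n"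
  assumes J: "J \<ge> 1"
    and der: "\<And>j. j \<in> {1..J} \<Longrightarrow> ((\<lambda>s. u s j) has_vector_derivative u' j) (at t)"
  shows "((\<lambda>s. 1 / real J * (\<Sum>j=1..J. (norm (u s j - ens_mean J (u s)))\<^sup>2))
           has_real_derivative 2 / real J * (\<Sum>j=1..J. (u t j - ens_mean J (u t)) \<bullet> u' j)) (at t)"
proof -
  let ?e = "\<lambda>s j. u s j - ens_mean J (u s)"
  have mean: "((\<lambda>s. ens_mean J (u s)) has_derivative (\<lambda>x. x *\<^sub>R ens_mean J u')) (at t)"
    unfolding ens_mean_def
    by (rule has_derivative_eq_rhs, rule has_derivative_scaleR_right, rule has_derivative_sum,
        erule der[unfolded has_vector_derivative_def])
       (simp add: scaleR_sum_right mult_ac)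
  have e: "((\<lambda>s. ?e s j) has_derivative (\<lambda>x. x *\<^sub>R (u' j - ens_mean J u'))) (at t)"
    if "j \<in> {1..J}" for j
    using has_derivative_diff[OF der[OF that, unfolded has_vector_derivative_def] mean]
    by (simp add: scaleR_diff_right)
  have sq: "((\<lambda>s. (norm (?e s j))\<^sup>2) has_real_derivative 2 * (?e t j \<bullet> (u' j - ens_mean J u'))) (at t)"
    if "j \<in> {1..J}" for j
    unfolding has_field_derivative_def power2_norm_eq_inner
    by (rule has_derivative_eq_rhs[OF has_derivative_inner[OF e[OF that] e[OF that]]])
       (simp add: inner_commute algebra_simps fun_eq_iff)
  have "((\<lambda>s. 1 / real J * (\<Sum>j=1..J. (norm (?e s j))\<^sup>2)) has_real_derivative
          1 / real J * (\<Sum>j=1..J. 2 * (?e t j \<bullet> (u' j - ens_mean J u')))) (at t)"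
    by (intro DERIV_cmult DERIV_sum sq)
  moreover have "(\<Sum>j=1..J. 2 * (?e t j \<bullet> (u' j - ens_mean J u'))) = 2 * (\<Sum>j=1..J. ?e t j \<bullet> u' j)"
    by (simp add: inner_diff_right sum_subtractf sum_deviation_inner_const[OF J]
        del: One_nat_def flip: sum_distrib_left)
  ultimately show ?thesis by simp
qed

section \<open>Decay under a slowly vanishing rate\<close>

text \<open>As \<open>t powr \<alpha>\<close> grows more slowly than \<open>t\<close>, there is a time \<open>T\<close> after which the decay rate
  \<open>k / (t powr \<alpha> + R)\<close> is at least \<open>1/t\<close>, however small \<open>k\<close> is.  A decay at rate \<open>1/t\<close> is that of
  the function \<open>1/t\<close> itself: the product \<open>t * V t\<close> does not increase after \<open>T\<close>.\<close>

lemma decay_from_vanishing_rate: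
  fixes V :: "real \<Rightarrow> real"
  assumes "k > 0" and "0 < \<alpha>" and "\<alpha> < 1" and "R > 0"
    and der: "\<And>t. t > 0 \<Longrightarrow> (V has_real_derivative V' t) (at t)"
    and le: "\<And>t. t > 0 \<Longrightarrow> V' t \<le> - (k / (t powr \<alpha> + R) * V t)"
    and nonneg: "\<And>t. t > 0 \<Longrightarrow> V t \<ge> 0"
  shows "V \<in> O[at_top](\<lambda>t. 1 / t)"
proof -
  have "eventually (\<lambda>t::real. t powr \<alpha> + R \<le> k * t) at_top"
    using assms(1-4) by real_asymp
  then obtain T0 where T0: "\<And>t. t \<ge> T0 \<Longrightarrow> t powr \<alpha> + R \<le> k * t"
    by (auto simp: eventually_at_top_linorder)
  define T where "T = max T0 1"
  have T: "T > 0" "T \<ge> T0" by (auto simp: T_def)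
  have mono: "t * V t \<le> T * V T" if "t \<ge> T" for t
  proof (rule DERIV_nonpos_imp_nonincreasing[OF that])
    fix s assume s: "T \<le> s" "s \<le> t"
    then have s0: "s > 0" using T by simp
    have "((\<lambda>t. t * V t) has_real_derivative 1 * V s + V' s * s) (at s)"
      by (rule DERIV_mult[OF DERIV_ident der[OF s0]])
    moreover have "1 * V s + V' s * s \<le> 0"
    proof -
      have pos: "s powr \<alpha> + R > 0" using \<open>R > 0\<close> by (simp add: add_nonneg_pos)
      have "1 \<le> k / (s powr \<alpha> + R) * s" using T0[of s] s T pos by (simp add: field_simps)
      then have "1 * V s \<le> k / (s powr \<alpha> + R) * s * V s"
        by (rule mult_right_mono) (rule nonneg[OF s0])
      moreover have "V' s * s \<le> - (k / (s powr \<alpha> + R) * V s) * s"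
        by (rule mult_right_mono[OF le[OF s0]]) (use s0 in simp)
      ultimately show ?thesis by (simp add: mult_ac)
    qed
    ultimately show "\<exists>d. ((\<lambda>t. t * V t) has_real_derivative d) (at s) \<and> d \<le> 0" by blast
  qed
  show ?thesis
  proof (rule bigoI)
    show "eventually (\<lambda>t. norm (V t) \<le> T * V T * norm (1 / t)) at_top"
      using eventually_ge_at_top[of T]
    proof eventually_elim
      case (elim t)
      then show ?case using mono[OF elim] nonneg[of t] T by (simp add: field_simps)
    qed
  qed
qed

section \<open>Ensemble collapse\<close>

theorem proposition3p6:
  fixes A :: "real^'n^'k" and y :: "real^'k" and \<Gamma> :: "real^'k^'k"
    and c :: "nat \<Rightarrow> 'n" and m J :: nat and a b :: "nat \<Rightarrow> real"
    and \<iota> \<alpha> R :: real and \<epsilon> :: "real \<Rightarrow> real"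
    and u0 :: "nat \<Rightarrow> real^'n" and u :: "real \<Rightarrow> nat \<Rightarrow> real^'n"
  assumes "bij_betw c {1..CARD('n)} UNIV" and "m \<le> CARD('n)" and "J \<ge> 1"
    and "pos_def_matrix \<Gamma>"
    and "\<iota> > 0"
    and "pos_def_matrix (transpose A ** matrix_inv \<Gamma> ** A)"
    and "0 < \<alpha>" and "\<alpha> < 1" and "R > 0"
    and "\<And>t. t \<ge> 0 \<Longrightarrow> \<epsilon> t = 1 / (t powr \<alpha> + R)"
    and "\<And>j. j \<in> {1..J} \<Longrightarrow> u0 j \<in> box_domain c m a b"
    and "\<And>i j. i \<in> {1..2*m} \<Longrightarrow> j \<in> {1..J} \<Longrightarrow> box_constraint c m a b i (u0 j) < 0"
    and "\<And>j. j \<in> {1..J} \<Longrightarrow> u 0 j = u0 j"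
    and "\<And>t j. t \<ge> 0 \<Longrightarrow> j \<in> {1..J} \<Longrightarrow>
           ((\<lambda>s. u s j) has_vector_derivative
              eki_rhs c m a b (Phi A y \<Gamma>) \<iota> J (\<epsilon> t) (u t) j) (at t within {0..})"
    and "\<And>t i j. t \<ge> 0 \<Longrightarrow> i \<in> {1..2*m} \<Longrightarrow> j \<in> {1..J} \<Longrightarrow>
           box_constraint c m a b i (u t j) < 0"
  shows "(\<lambda>t. 1 / real J * (\<Sum>j=1..J. (norm (u t j - ens_mean J (u t)))\<^sup>2))
           \<in> O[at_top](\<lambda>t. t powr (-(1 - \<alpha>)))"
proof -
  let ?V = "\<lambda>t. 1 / real J * (\<Sum>j=1..J. (norm (u t j - ens_mean J (u t)))\<^sup>2)"
  let ?rhs = "\<lambda>t. eki_rhs c m a b (Phi A y \<Gamma>) \<iota> J (\<epsilon> t) (u t)"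
  let ?V' = "\<lambda>t. 2 / real J * (\<Sum>j=1..J. (u t j - ens_mean J (u t)) \<bullet> ?rhs t j)"
  obtain l where l: "l > 0"
      "\<And>x. l * (norm x)\<^sup>2 \<le> x \<bullet> ((transpose A ** matrix_inv \<Gamma> ** A) *v x)"
    using pos_def_matrix_coercive[OF assms(6)] by blast
  have "?V \<in> O[at_top](\<lambda>t. 1 / t)"
  proof (rule decay_from_vanishing_rate)
    show "2 * \<iota> * l > 0" using \<open>\<iota> > 0\<close> l by simp
    fix t :: real assume t: "t > 0"
    have "at t within {0..} = at t" using t by (intro at_within_interior) simp
    then show "(?V has_real_derivative ?V' t) (at t)"
      using assms(14)[of t] t by (intro has_real_derivative_ensemble_spread \<open>J \<ge> 1\<close>) simp_all
    have eps: "\<epsilon> t = 1 / (t powr \<alpha> + R)" using assms(10) t by simp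
    have "\<epsilon> t \<ge> 0" unfolding eps using \<open>R > 0\<close> by simp
    have "(\<Sum>j=1..J. (u t j - ens_mean J (u t)) \<bullet> ?rhs t j)
        \<le> - (\<iota> * \<epsilon> t * l * (\<Sum>j=1..J. (norm (u t j - ens_mean J (u t)))\<^sup>2))"
      using t \<open>\<iota> > 0\<close> l
      by (intro eki_rhs_dissipative assms(3,4,15) \<open>\<epsilon> t \<ge> 0\<close>) simp_all
    from mult_left_mono[OF this, of "2 / real J"]
    show "?V' t \<le> - (2 * \<iota> * l / (t powr \<alpha> + R) * ?V t)"
      by (simp add: eps mult_ac)
    show "?V t \<ge> 0" by (simp add: sum_nonneg)
  qed (use assms in simp_all)
  also have "(\<lambda>t. 1 / t) \<in> O[at_top](\<lambda>t::real. t powr (-(1 - \<alpha>)))"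
    using \<open>0 < \<alpha>\<close> by real_asymp
  finally show ?thesis .
qed

end
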